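(* Let $X$ be a topological space and let $\lambda$ and $\mu$ be infinite cardinals. The following are equivalent. (1) $X$ is $\mathcal O$-$[\mu,\lambda]$-compact. (2) For every sequence $\{O_Z\mid Z\in S_\mu(\lambda)\}$ of nonempty open sets of $X$, there exists an ultrafilter $D$ over $S_\mu(\lambda)$ which covers $\lambda$ and such that $\{O_Z\mid Z\in S_\mu(\lambda)\}$ has a $D$-limit point in $X$.
   Context: No separation axiom is assumed. $S_\mu(\lambda)$ denotes the set of all subsets of $\lambda$ of cardinality $<\mu$. "Sequence" means an indexed family (repetitions allowed). A topological space $X$ is $\mathcal O$-$[\mu,\lambda]$-compact if for every sequence $(C_\alpha)_{\alpha\in\lambda}$ of closed sets of $X$ the following holds: if for every $Z\subseteq\lambda$ with $|Z|<\mu$ there exists a nonempty open set $O_Z$ of $X$ such that $\bigcap_{\alpha\in Z}C_\alpha\supseteq O_Z$, then $\bigcap_{\alpha\in\lambda}C_\alpha\neq\emptyset$ (the intersection over $Z=\emptyset$ is $X$). If $D$ is an ultrafilter over a set $I$ and $(Y_i)_{i\in I}$ is a sequence of subsets of $X$, a point $x\in X$ is a $D$-limit point of $(Y_i)_{i\in I}$ if $\{i\in I\mid Y_i\cap U\neq\emptyset\}\in D$ for every neighborhood $U$ of $x$ in $X$. An ultrafilter $D$ over $S_\mu(\lambda)$ covers $\lambda$ if $\{Z\in S_\mu(\lambda)\mid\alpha\in Z\}\in D$ for every $\alpha\in\lambda$. *)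

theory Defs
  imports "HOL-Analysis.Analysis"
begin

unbundle cardinal_syntax

text \<open>
  A cardinal is represented by a relation \<open>r\<close> with \<^prop>\<open>Card_order r\<close>; its elements
  (the ordinals \<open>\<alpha> \<in> \<lambda>\<close>) are the members of \<^term>\<open>Field r\<close>. The cardinals \<open>\<mu>\<close> and \<open>\<lambda>\<close>
  may live on different types, so neither is assumed to be bounded by the other.
\<close>

definition small_subsets :: "'c rel \<Rightarrow> 'b rel \<Rightarrow> 'b set set" where
  "small_subsets \<mu> lam = {Z. Z \<subseteq> Field lam \<and> |Z| <o \<mu>}"

text \<open>Intersecting with \<^term>\<open>topspace X\<close> makes the empty intersection equal to the whole space.\<close>

definition O_compact :: "'c rel \<Rightarrow> 'b rel \<Rightarrow> 'a topology \<Rightarrow> bool" where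
  "O_compact \<mu> lam X \<longleftrightarrow>
    (\<forall>C :: 'b \<Rightarrow> 'a set.
      (\<forall>\<alpha>\<in>Field lam. closedin X (C \<alpha>)) \<longrightarrow>
      (\<forall>Z\<in>small_subsets \<mu> lam.
         \<exists>U. openin X U \<and> U \<noteq> {} \<and> U \<subseteq> topspace X \<inter> (\<Inter>\<alpha>\<in>Z. C \<alpha>)) \<longrightarrow>
      topspace X \<inter> (\<Inter>\<alpha>\<in>Field lam. C \<alpha>) \<noteq> {})"

definition ultrafilter_over :: "'i set \<Rightarrow> 'i set set \<Rightarrow> bool" where
  "ultrafilter_over I D \<longleftrightarrow>
    D \<subseteq> Pow I \<and> I \<in> D \<and> {} \<notin> D \<and>
    (\<forall>A\<in>D. \<forall>B\<in>D. A \<inter> B \<in> D) \<and>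
    (\<forall>A\<in>D. \<forall>B. A \<subseteq> B \<and> B \<subseteq> I \<longrightarrow> B \<in> D) \<and>
    (\<forall>A. A \<subseteq> I \<longrightarrow> A \<in> D \<or> I - A \<in> D)"

definition ultrafilter_limit_point ::
  "'a topology \<Rightarrow> 'i set \<Rightarrow> 'i set set \<Rightarrow> ('i \<Rightarrow> 'a set) \<Rightarrow> 'a \<Rightarrow> bool" where
  "ultrafilter_limit_point X I D Y x \<longleftrightarrow>
    x \<in> topspace X \<and>
    (\<forall>U. U \<subseteq> topspace X \<and> (\<exists>V. openin X V \<and> x \<in> V \<and> V \<subseteq> U) \<longrightarrow>
       {i \<in> I. Y i \<inter> U \<noteq> {}} \<in> D)"

definition covers :: "'c rel \<Rightarrow> 'b rel \<Rightarrow> 'b set set set \<Rightarrow> bool" where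
  "covers \<mu> lam D \<longleftrightarrow>
    (\<forall>\<alpha>\<in>Field lam. {Z \<in> small_subsets \<mu> lam. \<alpha> \<in> Z} \<in> D)"

end

theory Submission
  imports Defs "HOL-Algebra.Free_Abelian_Groups"
begin

text \<open>
  A limit point \<open>x\<close> for an ultrafilter covering \<open>\<lambda>\<close> must lie in every \<open>C \<alpha>\<close> as soon as \<open>W Z\<close>
  is contained in \<open>C \<alpha>\<close> for each \<open>Z\<close> containing \<open>\<alpha>\<close>: otherwise the complement of \<open>C \<alpha>\<close> is a
  neighbourhood of \<open>x\<close>, and some \<open>Z\<close> containing \<open>\<alpha>\<close> has \<open>W Z\<close> meeting this complement. This
  gives compactness.

  Conversely, an ultrafilter covering \<open>\<lambda>\<close> with limit point \<open>x\<close> exists once every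
  neighbourhood \<open>V\<close> of \<open>x\<close> and every finite \<open>F \<subseteq> \<lambda>\<close> admit some \<open>Z \<supseteq> F\<close> with \<open>W Z\<close> meeting
  \<open>V\<close>, because the sets of such \<open>Z\<close> form a filter base. This says that \<open>x\<close> lies in the closure of
  \<open>\<Union>{W Z | F \<subseteq> Z}\<close> for every finite \<open>F\<close>. The closures for singletons \<open>F\<close>
  alone would not suffice, so compactness is applied to a family indexed by the finite subsets
  of \<open>\<lambda>\<close>. That is legitimate because there are only \<open>\<lambda>\<close> many of them
  (\<open>O_compact_Fpow\<close>), and the hypothesis of compactness can be checked because a union of fewer
  than \<open>\<mu>\<close> finite sets still has fewer than \<open>\<mu>\<close> elements (\<open>small_Union_finite\<close>).
\<close>

section \<open>Ultrafilters from the finite intersection property\<close>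

text \<open>
  A maximal family with the finite intersection property is an ultrafilter: it contains each set
  that can be added without losing the property. If neither \<open>A\<close> nor its complement could be
  added, two finite subfamilies would witness this, and their union would have empty
  intersection.
\<close>

lemma ex_ultrafilter_over_fip:
  assumes sub: "\<A> \<subseteq> Pow I"
    and fip: "\<And>\<F>. finite \<F> \<Longrightarrow> \<F> \<subseteq> \<A> \<Longrightarrow> I \<inter> \<Inter>\<F> \<noteq> {}"
  shows "\<exists>D. ultrafilter_over I D \<and> \<A> \<subseteq> D"
proof -
  define fip_on where
    "fip_on \<B> \<longleftrightarrow> (\<forall>\<F>. finite \<F> \<and> \<F> \<subseteq> \<B> \<longrightarrow> I \<inter> \<Inter>\<F> \<noteq> {})" for \<B> :: "'a set set"
  define \<P> where "\<P> = {\<B>. \<A> \<subseteq> \<B> \<and> \<B> \<subseteq> Pow I \<and> fip_on \<B>}"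
  have \<A>\<P>: "\<A> \<in> \<P>"
    using sub fip by (auto simp: \<P>_def fip_on_def)
  have "\<exists>M\<in>\<P>. \<forall>\<B>\<in>\<P>. M \<subseteq> \<B> \<longrightarrow> \<B> = M"
  proof (rule subset_Zorn_nonempty)
    show "\<P> \<noteq> {}" using \<A>\<P> by blast
    fix \<C> assume ne: "\<C> \<noteq> {}" and chain: "subset.chain \<P> \<C>"
    have \<C>\<P>: "\<C> \<subseteq> \<P>" using chain by (simp add: subset.chain_def)
    have "I \<inter> \<Inter>\<F> \<noteq> {}" if \<F>: "finite \<F>" "\<F> \<subseteq> \<Union>\<C>" for \<F>
    proof -
      obtain \<B> where "\<B> \<in> \<C>" "\<F> \<subseteq> \<B>"
        using \<F> ne chain by (rule finite_subset_Union_chain)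
      then show ?thesis using \<C>\<P> \<open>finite \<F>\<close> by (auto simp: \<P>_def fip_on_def)
    qed
    moreover have "\<A> \<subseteq> \<Union>\<C>" "\<Union>\<C> \<subseteq> Pow I"
      using ne \<C>\<P> unfolding \<P>_def by blast+
    ultimately show "\<Union>\<C> \<in> \<P>" by (simp add: \<P>_def fip_on_def)
  qed
  then obtain M where "M \<in> \<P>" and max: "\<And>\<B>. \<B> \<in> \<P> \<Longrightarrow> M \<subseteq> \<B> \<Longrightarrow> \<B> = M"
    by blast
  then have \<A>M: "\<A> \<subseteq> M" and MI: "M \<subseteq> Pow I"
    and Mfip: "\<And>\<F>. finite \<F> \<Longrightarrow> \<F> \<subseteq> M \<Longrightarrow> I \<inter> \<Inter>\<F> \<noteq> {}"
    by (auto simp: \<P>_def fip_on_def)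
  have maxD: "\<exists>\<F>. finite \<F> \<and> \<F> \<subseteq> M \<and> A \<inter> \<Inter>\<F> = {}" if A: "A \<subseteq> I" "A \<notin> M" for A
  proof -
    have "insert A M \<notin> \<P>" using max[of "insert A M"] A by blast
    then obtain \<G> where \<G>: "finite \<G>" "\<G> \<subseteq> insert A M" "I \<inter> \<Inter>\<G> = {}"
      using \<A>M MI A(1) by (auto simp: \<P>_def fip_on_def)
    moreover have "A \<inter> \<Inter>(\<G> - {A}) \<subseteq> I \<inter> \<Inter>\<G>" using A(1) by blast
    ultimately show ?thesis by (intro exI[of _ "\<G> - {A}"]) auto
  qed
  \<comment> \<open>All closure properties of the ultrafilter at once: a maximal family contains every
    subset of \<open>I\<close> that includes a finite intersection of members.\<close>
  have closed: "A \<in> M" if A: "A \<subseteq> I" and \<G>: "finite \<G>" "\<G> \<subseteq> M" "I \<inter> \<Inter>\<G> \<subseteq> A" for A \<G>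
  proof (rule ccontr)
    assume "A \<notin> M"
    with maxD[OF A] obtain \<F> where \<F>: "finite \<F>" "\<F> \<subseteq> M" "A \<inter> \<Inter>\<F> = {}" by blast
    have "I \<inter> \<Inter>(\<F> \<union> \<G>) \<noteq> {}" using \<F> \<G> by (intro Mfip) auto
    then show False using \<F>(3) \<G>(3) unfolding Inf_union_distrib by blast
  qed
  have "I \<in> M" using closed[of I "{}"] by simp
  moreover have "{} \<notin> M" using Mfip[of "{{}}"] by auto
  moreover have "A \<inter> B \<in> M" if "A \<in> M" "B \<in> M" for A B
    using closed[of "A \<inter> B" "{A, B}"] that MI by auto
  moreover have "B \<in> M" if "A \<in> M" "A \<subseteq> B" "B \<subseteq> I" for A B
    using closed[of B "{A}"] that by auto
  moreover have "A \<in> M \<or> I - A \<in> M" if A: "A \<subseteq> I" for A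
  proof (rule ccontr)
    assume "\<not> ?thesis"
    then have "A \<notin> M" "I - A \<notin> M" by auto
    with maxD[OF A] maxD[of "I - A"] obtain \<F> \<G>
      where \<F>: "finite \<F>" "\<F> \<subseteq> M" "A \<inter> \<Inter>\<F> = {}"
        and \<G>: "finite \<G>" "\<G> \<subseteq> M" "(I - A) \<inter> \<Inter>\<G> = {}"
      by (metis Diff_subset)
    have "I \<inter> \<Inter>(\<F> \<union> \<G>) \<noteq> {}" using \<F> \<G> by (intro Mfip) auto
    then show False using \<F>(3) \<G>(3) unfolding Inf_union_distrib by blast
  qed
  ultimately have "ultrafilter_over I M"
    using MI unfolding ultrafilter_over_def by blast
  then show ?thesis using \<A>M by blast
qed

lemma ex_ultrafilter_over_filter_base:
  assumes sub: "\<B> \<subseteq> Pow I" and ne: "\<B> \<noteq> {}" and nonempty: "{} \<notin> \<B>"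
    and dir: "\<And>A B. A \<in> \<B> \<Longrightarrow> B \<in> \<B> \<Longrightarrow> \<exists>C\<in>\<B>. C \<subseteq> A \<inter> B"
  shows "\<exists>D. ultrafilter_over I D \<and> \<B> \<subseteq> D"
proof (rule ex_ultrafilter_over_fip[OF sub])
  fix \<F> assume "finite \<F>" "\<F> \<subseteq> \<B>"
  then have "\<exists>C\<in>\<B>. C \<subseteq> I \<inter> \<Inter>\<F>"
  proof (induction \<F> rule: finite_induct)
    case empty
    then show ?case using ne sub by auto
  next
    case (insert A \<F>)
    then obtain C where C: "C \<in> \<B>" "C \<subseteq> I \<inter> \<Inter>\<F>" by auto
    with dir[of A C] insert.prems obtain E where "E \<in> \<B>" "E \<subseteq> A \<inter> C" by auto
    then show ?case using C(2) by (intro bexI[of _ E]) auto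
  qed
  then show "I \<inter> \<Inter>\<F> \<noteq> {}" using nonempty by (metis subset_empty)
qed

section \<open>Small families of finite sets\<close>

lemma small_Union_finite:
  assumes \<mu>: "Cinfinite \<mu>" and small: "|\<Z>| <o \<mu>" and fin: "\<And>F. F \<in> \<Z> \<Longrightarrow> finite F"
  shows "|\<Union>\<Z>| <o \<mu>"
proof (cases "finite \<Z>")
  case True
  then have "finite (\<Union>\<Z>)" using fin by blast
  then show ?thesis
    using \<mu> finite_ordLess_infinite[of "|\<Union>\<Z>|" \<mu>]
    by (auto simp: cinfinite_def card_order_on_well_order_on)
next
  case False
  have "|F| \<le>o |\<Z>|" if "F \<in> \<Z>" for F
    using fin[OF that] False by (simp add: ordLess_imp_ordLeq)
  then have "|\<Union>F\<in>\<Z>. F| \<le>o |\<Z>|"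
    by (intro card_of_UNION_ordLeq_infinite[OF False]) auto
  then show ?thesis using small by (auto intro: ordLeq_ordLess_trans)
qed

text \<open>
  An infinite cardinal has as many finite subsets as elements, so compactness may be applied to
  families indexed by the finite subsets instead.
\<close>

lemma O_compact_Fpow:
  fixes C :: "'b set \<Rightarrow> 'a set"
  assumes lam: "Cinfinite lam" and comp: "O_compact \<mu> lam X"
    and closed: "\<And>F. F \<in> Fpow (Field lam) \<Longrightarrow> closedin X (C F)"
    and opens: "\<And>\<Z>. \<Z> \<subseteq> Fpow (Field lam) \<Longrightarrow> |\<Z>| <o \<mu> \<Longrightarrow>
      \<exists>U. openin X U \<and> U \<noteq> {} \<and> U \<subseteq> topspace X \<inter> (\<Inter>F\<in>\<Z>. C F)"
  shows "topspace X \<inter> (\<Inter>F\<in>Fpow (Field lam). C F) \<noteq> {}"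
proof -
  have "infinite (Field lam)" using lam by (simp add: cinfinite_def)
  then obtain g where "bij_betw g (Field lam) (Fpow (Field lam))"
    using eqpoll_sym[OF eqpoll_Fpow] unfolding eqpoll_def by blast
  then have im: "g ` Field lam = Fpow (Field lam)" by (simp add: bij_betw_def)
  have "topspace X \<inter> (\<Inter>\<alpha>\<in>Field lam. C (g \<alpha>)) \<noteq> {}"
  proof (rule comp[unfolded O_compact_def, rule_format])
    show "closedin X (C (g \<alpha>))" if "\<alpha> \<in> Field lam" for \<alpha>
      using closed im that by blast
    fix Z assume "Z \<in> small_subsets \<mu> lam"
    then have "Z \<subseteq> Field lam" "|Z| <o \<mu>" by (auto simp: small_subsets_def)
    then have "g ` Z \<subseteq> Fpow (Field lam)" "|g ` Z| <o \<mu>"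
      using im ordLeq_ordLess_trans[OF card_of_image] by auto
    from opens[OF this]
    show "\<exists>U. openin X U \<and> U \<noteq> {} \<and> U \<subseteq> topspace X \<inter> (\<Inter>\<alpha>\<in>Z. C (g \<alpha>))"
      by simp
  qed
  then show ?thesis unfolding im[symmetric] by simp
qed

section \<open>Compactness and ultrafilter limit points\<close>

text \<open>
  Membership of \<open>x\<close> in the closure of \<open>\<Union>{W Z | F \<subseteq> Z}\<close> is exactly the required meeting
  property for \<open>F\<close>. For a small family \<open>\<Z>\<close> of finite sets, the closures belonging to members
  of \<open>\<Z>\<close> all contain the nonempty open set \<open>W (\<Union>\<Z>)\<close>, since \<open>\<Union>\<Z>\<close> is itself an index.
\<close>

lemma ex_point_meeting_large_sets:
  assumes lam: "Cinfinite lam" and \<mu>: "Cinfinite \<mu>" and comp: "O_compact \<mu> lam X"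
    and W: "\<And>Z. Z \<in> small_subsets \<mu> lam \<Longrightarrow> openin X (W Z) \<and> W Z \<noteq> {}"
  shows "\<exists>x\<in>topspace X. \<forall>F V. F \<in> Fpow (Field lam) \<and> openin X V \<and> x \<in> V \<longrightarrow>
    (\<exists>Z\<in>small_subsets \<mu> lam. F \<subseteq> Z \<and> W Z \<inter> V \<noteq> {})"
proof -
  define C where
    "C F = X closure_of (\<Union>{W Z | Z. Z \<in> small_subsets \<mu> lam \<and> F \<subseteq> Z})" for F
  have "topspace X \<inter> (\<Inter>F\<in>Fpow (Field lam). C F) \<noteq> {}"
  proof (rule O_compact_Fpow[OF lam comp])
    show "closedin X (C F)" for F by (simp add: C_def)
    fix \<Z> assume \<Z>: "\<Z> \<subseteq> Fpow (Field lam)" "|\<Z>| <o \<mu>"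
    have "|\<Union>\<Z>| <o \<mu>"
      using small_Union_finite[OF \<mu> \<Z>(2)] \<Z>(1) by (auto simp: Fpow_def)
    then have small: "\<Union>\<Z> \<in> small_subsets \<mu> lam"
      using \<Z>(1) by (auto simp: small_subsets_def Fpow_def)
    then have sub: "W (\<Union>\<Z>) \<subseteq> topspace X" using W openin_subset by blast
    have "W (\<Union>\<Z>) \<subseteq> C F" if "F \<in> \<Z>" for F
    proof -
      have "W (\<Union>\<Z>) \<subseteq> \<Union>{W Z | Z. Z \<in> small_subsets \<mu> lam \<and> F \<subseteq> Z}"
        using small that by blast
      then show ?thesis
        unfolding C_def using closure_of_mono closure_of_subset[OF sub] by blast
    qed
    then show "\<exists>U. openin X U \<and> U \<noteq> {} \<and> U \<subseteq> topspace X \<inter> (\<Inter>F\<in>\<Z>. C F)"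
      using W[OF small] sub by blast
  qed
  then obtain x where x: "x \<in> topspace X" "\<And>F. F \<in> Fpow (Field lam) \<Longrightarrow> x \<in> C F"
    by blast
  have "\<exists>Z\<in>small_subsets \<mu> lam. F \<subseteq> Z \<and> W Z \<inter> V \<noteq> {}"
    if "F \<in> Fpow (Field lam)" "openin X V" "x \<in> V" for F V
    using x(2)[OF that(1)] that(2,3) unfolding C_def in_closure_of by blast
  then show ?thesis using x(1) by blast
qed

lemma O_compact_imp_limit_point:
  assumes lam: "Cinfinite lam" and \<mu>: "Cinfinite \<mu>" and comp: "O_compact \<mu> lam X"
    and W: "\<And>Z. Z \<in> small_subsets \<mu> lam \<Longrightarrow> openin X (W Z) \<and> W Z \<noteq> {}"
  shows "\<exists>D. ultrafilter_over (small_subsets \<mu> lam) D \<and> covers \<mu> lam D \<and>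
    (\<exists>x. ultrafilter_limit_point X (small_subsets \<mu> lam) D W x)"
proof -
  let ?S = "small_subsets \<mu> lam"
  obtain x where xX: "x \<in> topspace X"
    and x: "\<And>F V. F \<in> Fpow (Field lam) \<Longrightarrow> openin X V \<Longrightarrow> x \<in> V \<Longrightarrow>
      \<exists>Z\<in>?S. F \<subseteq> Z \<and> W Z \<inter> V \<noteq> {}"
    using ex_point_meeting_large_sets[OF lam \<mu> comp, of W] W by metis
  define B where "B F V = {Z \<in> ?S. F \<subseteq> Z \<and> W Z \<inter> V \<noteq> {}}" for F V
  define \<B> where "\<B> = {B F V | F V. F \<in> Fpow (Field lam) \<and> openin X V \<and> x \<in> V}"
  have \<B>I: "B F V \<in> \<B>" if "F \<in> Fpow (Field lam)" "openin X V" "x \<in> V" for F V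
    using that by (auto simp: \<B>_def)
  have "\<exists>D. ultrafilter_over ?S D \<and> \<B> \<subseteq> D"
  proof (rule ex_ultrafilter_over_filter_base)
    show "\<B> \<subseteq> Pow ?S" by (auto simp: \<B>_def B_def)
    show "\<B> \<noteq> {}" using \<B>I[of "{}" "topspace X"] xX by (auto simp: Fpow_def)
    have "B F V \<noteq> {}" if "F \<in> Fpow (Field lam)" "openin X V" "x \<in> V" for F V
      using x[OF that] unfolding B_def by blast
    then show "{} \<notin> \<B>" unfolding \<B>_def by blast
    fix P Q assume "P \<in> \<B>" "Q \<in> \<B>"
    then obtain F V G U where P: "P = B F V" "F \<in> Fpow (Field lam)" "openin X V" "x \<in> V"
      and Q: "Q = B G U" "G \<in> Fpow (Field lam)" "openin X U" "x \<in> U"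
      by (auto simp: \<B>_def)
    have "B (F \<union> G) (V \<inter> U) \<in> \<B>"
      using P Q by (intro \<B>I) (auto simp: Fpow_def)
    moreover have "B (F \<union> G) (V \<inter> U) \<subseteq> P \<inter> Q" using P Q by (auto simp: B_def)
    ultimately show "\<exists>R\<in>\<B>. R \<subseteq> P \<inter> Q" by blast
  qed
  then obtain D where D: "ultrafilter_over ?S D" and \<B>D: "\<B> \<subseteq> D" by blast
  \<comment> \<open>Covering \<open>\<alpha>\<close> is the case \<open>F = {\<alpha>}\<close> with \<open>V\<close> the whole space; the limit point property is
    the case \<open>F = {}\<close>.\<close>
  have up: "T \<in> D" if "B F V \<subseteq> T" "T \<subseteq> ?S" "F \<in> Fpow (Field lam)" "openin X V" "x \<in> V"
    for F V T
  proof -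
    have "B F V \<in> D" using \<B>D \<B>I that(3-5) by blast
    then show ?thesis using D that(1,2) by (auto simp: ultrafilter_over_def)
  qed
  have "covers \<mu> lam D"
    unfolding covers_def
  proof
    fix \<alpha> assume "\<alpha> \<in> Field lam"
    then show "{Z \<in> ?S. \<alpha> \<in> Z} \<in> D"
      using xX by (intro up[of "{\<alpha>}" "topspace X"]) (auto simp: B_def Fpow_def)
  qed
  moreover have "ultrafilter_limit_point X ?S D W x"
    unfolding ultrafilter_limit_point_def
  proof (intro conjI allI impI)
    fix U assume "U \<subseteq> topspace X \<and> (\<exists>V. openin X V \<and> x \<in> V \<and> V \<subseteq> U)"
    then obtain V where "openin X V" "x \<in> V" "V \<subseteq> U" by blast
    then show "{Z \<in> ?S. W Z \<inter> U \<noteq> {}} \<in> D"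
      by (intro up[of "{}" V]) (auto simp: B_def Fpow_def)
  qed (rule xX)
  ultimately show ?thesis using D by blast
qed

lemma limit_point_in_closed:
  assumes D: "ultrafilter_over (small_subsets \<mu> lam) D" and cov: "covers \<mu> lam D"
    and lim: "ultrafilter_limit_point X (small_subsets \<mu> lam) D W x"
    and \<alpha>: "\<alpha> \<in> Field lam" and closed: "closedin X K"
    and W: "\<And>Z. Z \<in> small_subsets \<mu> lam \<Longrightarrow> \<alpha> \<in> Z \<Longrightarrow> W Z \<subseteq> K"
  shows "x \<in> K"
proof (rule ccontr)
  let ?S = "small_subsets \<mu> lam" and ?U = "topspace X - K"
  have Int: "P \<inter> Q \<in> D" if "P \<in> D" "Q \<in> D" for P Q
    using D that by (simp add: ultrafilter_over_def)
  assume "x \<notin> K"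
  then have "openin X ?U" "x \<in> ?U"
    using closed lim by (auto simp: ultrafilter_limit_point_def)
  then have meet: "{Z \<in> ?S. W Z \<inter> ?U \<noteq> {}} \<in> D"
    using lim unfolding ultrafilter_limit_point_def by blast
  have "{Z \<in> ?S. \<alpha> \<in> Z} \<in> D" using cov \<alpha> by (simp add: covers_def)
  then have "{Z \<in> ?S. W Z \<inter> ?U \<noteq> {}} \<inter> {Z \<in> ?S. \<alpha> \<in> Z} \<in> D"
    using meet by (intro Int)
  moreover have "{} \<notin> D" using D by (simp add: ultrafilter_over_def)
  ultimately have "{Z \<in> ?S. W Z \<inter> ?U \<noteq> {}} \<inter> {Z \<in> ?S. \<alpha> \<in> Z} \<noteq> {}"
    by (metis (no_types))
  then show False using W by blast
qed

theorem theorem3p2: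
  fixes X :: "'a topology" and lam :: "'b rel" and \<mu> :: "'c rel"
  assumes "Cinfinite lam" and "Cinfinite \<mu>"
  shows "O_compact \<mu> lam X \<longleftrightarrow>
    (\<forall>W :: 'b set \<Rightarrow> 'a set.
      (\<forall>Z\<in>small_subsets \<mu> lam. openin X (W Z) \<and> W Z \<noteq> {}) \<longrightarrow>
      (\<exists>D. ultrafilter_over (small_subsets \<mu> lam) D \<and> covers \<mu> lam D \<and>
        (\<exists>x. ultrafilter_limit_point X (small_subsets \<mu> lam) D W x)))"
    (is "?compact \<longleftrightarrow> ?limits")
proof
  assume ?compact
  then show ?limits using O_compact_imp_limit_point[OF assms] by blast
next
  assume limits: ?limits
  show ?compact
    unfolding O_compact_def
  proof (intro allI impI)
    fix C :: "'b \<Rightarrow> 'a set"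
    assume closed: "\<forall>\<alpha>\<in>Field lam. closedin X (C \<alpha>)"
      and "\<forall>Z\<in>small_subsets \<mu> lam.
        \<exists>U. openin X U \<and> U \<noteq> {} \<and> U \<subseteq> topspace X \<inter> (\<Inter>\<alpha>\<in>Z. C \<alpha>)"
    then obtain W where W: "\<And>Z. Z \<in> small_subsets \<mu> lam \<Longrightarrow>
        openin X (W Z) \<and> W Z \<noteq> {} \<and> W Z \<subseteq> topspace X \<inter> (\<Inter>\<alpha>\<in>Z. C \<alpha>)"
      by metis
    have "\<forall>Z\<in>small_subsets \<mu> lam. openin X (W Z) \<and> W Z \<noteq> {}" using W by blast
    with limits[THEN spec, of W] obtain D x
      where D: "ultrafilter_over (small_subsets \<mu> lam) D" "covers \<mu> lam D"
        "ultrafilter_limit_point X (small_subsets \<mu> lam) D W x"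
      by blast
    have "x \<in> C \<alpha>" if "\<alpha> \<in> Field lam" for \<alpha>
    proof (rule limit_point_in_closed[OF D that])
      show "closedin X (C \<alpha>)" using closed that by blast
      show "W Z \<subseteq> C \<alpha>" if "Z \<in> small_subsets \<mu> lam" "\<alpha> \<in> Z" for Z
        using W[OF that(1)] that(2) by blast
    qed
    moreover have "x \<in> topspace X" using D(3) by (simp add: ultrafilter_limit_point_def)
    ultimately show "topspace X \<inter> (\<Inter>\<alpha>\<in>Field lam. C \<alpha>) \<noteq> {}" by blast
  qed
qed

end
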